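(* Let $K$ be any non-singular simplicial set. The endofunctor $X\mapsto X\times K$ of the category $\mathrm{nsSet}$ of non-singular simplicial sets preserves all (small) colimits, where colimits are formed in $\mathrm{nsSet}$.
   Context: A simplicial set $X$ is non-singular if for each $n\ge0$ and each non-degenerate simplex $x\in X_n$ the representing map $\bar x\colon\Delta[n]\to X$ (corresponding to $x$ under the Yoneda lemma) is degreewise injective. $\mathrm{nsSet}$ denotes the full subcategory of the category $\mathrm{sSet}$ of simplicial sets on the non-singular simplicial sets. The inclusion $U\colon\mathrm{nsSet}\to\mathrm{sSet}$ has a left adjoint $D\colon\mathrm{sSet}\to\mathrm{nsSet}$ (desingularization), so $\mathrm{nsSet}$ has all small limits and colimits; limits (in particular the product $X\times K$) are computed as in $\mathrm{sSet}$, while the colimit of a diagram in $\mathrm{nsSet}$ is obtained by applying $D$ to the colimit in $\mathrm{sSet}$. *)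

theory Defs
  imports Main "HOL-Library.FuncSet" "HOL-Library.Equipollence"
begin

subsection \<open>Simplicial sets\<close>

text \<open>The morphisms \<open>[m] \<rightarrow> [n]\<close> of the simplex category, where \<open>[n] = {0, ..., n}\<close>; functions are
  extensional, so that HOL equality is equality of morphisms.\<close>

definition ord_maps :: "nat \<Rightarrow> nat \<Rightarrow> (nat \<Rightarrow> nat) set" where
  "ord_maps m n = {\<theta> \<in> {..m} \<rightarrow>\<^sub>E {..n}. mono_on {..m} \<theta>}"

text \<open>\<open>smp X n\<close> is the set of \<open>n\<close>-simplices. For \<open>\<theta> : [m] \<rightarrow> [n]\<close>, the induced map
  \<open>X\<^sub>n \<rightarrow> X\<^sub>m\<close> is \<open>act X m n \<theta>\<close>; its values outside \<open>smp X n\<close> are irrelevant.\<close>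

record 'a sset =
  smp :: "nat \<Rightarrow> 'a set"
  act :: "nat \<Rightarrow> nat \<Rightarrow> (nat \<Rightarrow> nat) \<Rightarrow> 'a \<Rightarrow> 'a"

definition simplicial_set :: "'a sset \<Rightarrow> bool" where
  "simplicial_set X \<longleftrightarrow>
     (\<forall>m n. \<forall>\<theta>\<in>ord_maps m n. act X m n \<theta> \<in> smp X n \<rightarrow> smp X m) \<and>
     (\<forall>n. \<forall>x\<in>smp X n. act X n n (\<lambda>i\<in>{..n}. i) x = x) \<and>
     (\<forall>l m n. \<forall>\<phi>\<in>ord_maps l m. \<forall>\<theta>\<in>ord_maps m n. \<forall>x\<in>smp X n.
        act X l n (compose {..l} \<theta> \<phi>) x = act X l m \<phi> (act X m n \<theta> x))"

text \<open>Simplicial maps are extensional in each degree.\<close>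

definition simplicial_map :: "'a sset \<Rightarrow> 'b sset \<Rightarrow> (nat \<Rightarrow> 'a \<Rightarrow> 'b) \<Rightarrow> bool" where
  "simplicial_map X Y f \<longleftrightarrow>
     (\<forall>n. f n \<in> smp X n \<rightarrow>\<^sub>E smp Y n) \<and>
     (\<forall>m n. \<forall>\<theta>\<in>ord_maps m n. \<forall>x\<in>smp X n. f m (act X m n \<theta> x) = act Y m n \<theta> (f n x))"

definition smap_id :: "'a sset \<Rightarrow> nat \<Rightarrow> 'a \<Rightarrow> 'a" where
  "smap_id X = (\<lambda>n. \<lambda>x\<in>smp X n. x)"

definition smap_comp ::
  "'a sset \<Rightarrow> (nat \<Rightarrow> 'b \<Rightarrow> 'c) \<Rightarrow> (nat \<Rightarrow> 'a \<Rightarrow> 'b) \<Rightarrow> nat \<Rightarrow> 'a \<Rightarrow> 'c" where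
  "smap_comp X g f = (\<lambda>n. compose (smp X n) (g n) (f n))"

subsection \<open>Non-singular simplicial sets\<close>

definition std_simplex :: "nat \<Rightarrow> (nat \<Rightarrow> nat) sset" where
  "std_simplex n = \<lparr>smp = (\<lambda>m. ord_maps m n), act = (\<lambda>l m \<phi> \<theta>. compose {..l} \<theta> \<phi>)\<rparr>"

text \<open>The map \<open>\<Delta>[n] \<rightarrow> X\<close> that corresponds to \<open>x \<in> X\<^sub>n\<close> under the Yoneda lemma.\<close>

definition rep_map :: "'a sset \<Rightarrow> nat \<Rightarrow> 'a \<Rightarrow> nat \<Rightarrow> (nat \<Rightarrow> nat) \<Rightarrow> 'a" where
  "rep_map X n x = (\<lambda>m. \<lambda>\<theta>\<in>smp (std_simplex n) m. act X m n \<theta> x)"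

definition degenerate :: "'a sset \<Rightarrow> nat \<Rightarrow> 'a \<Rightarrow> bool" where
  "degenerate X n x \<longleftrightarrow>
     (\<exists>m<n. \<exists>\<theta>\<in>ord_maps n m. \<theta> ` {..n} = {..m} \<and> (\<exists>y\<in>smp X m. x = act X n m \<theta> y))"

definition nonsingular :: "'a sset \<Rightarrow> bool" where
  "nonsingular X \<longleftrightarrow> simplicial_set X \<and>
     (\<forall>n. \<forall>x\<in>smp X n. \<not> degenerate X n x \<longrightarrow>
        (\<forall>m. inj_on (rep_map X n x m) (smp (std_simplex n) m)))"

subsection \<open>The functor \<open>X \<mapsto> X \<times> K\<close>\<close>

definition sset_prod :: "'a sset \<Rightarrow> 'b sset \<Rightarrow> ('a \<times> 'b) sset" (infixr "\<times>\<^sub>s" 80) where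
  "X \<times>\<^sub>s K = \<lparr>smp = (\<lambda>n. smp X n \<times> smp K n),
              act = (\<lambda>m n \<theta>. map_prod (act X m n \<theta>) (act K m n \<theta>))\<rparr>"

text \<open>The map \<open>f \<times> id : X \<times> K \<rightarrow> Y \<times> K\<close> for \<open>f : X \<rightarrow> Y\<close>.\<close>

definition smap_times ::
  "'a sset \<Rightarrow> 'k sset \<Rightarrow> (nat \<Rightarrow> 'a \<Rightarrow> 'b) \<Rightarrow> nat \<Rightarrow> 'a \<times> 'k \<Rightarrow> 'b \<times> 'k" where
  "smap_times X K f = (\<lambda>n. \<lambda>p\<in>smp (X \<times>\<^sub>s K) n. (f n (fst p), snd p))"

subsection \<open>Colimits in the category of non-singular simplicial sets\<close>

record ('o, 'm) cat =
  Obj :: "'o set"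
  Arr :: "'m set"
  Dom :: "'m \<Rightarrow> 'o"
  Cod :: "'m \<Rightarrow> 'o"
  Ident :: "'o \<Rightarrow> 'm"
  Comp :: "'m \<Rightarrow> 'm \<Rightarrow> 'm"

locale category =
  fixes C :: "('o, 'm) cat"
  assumes Dom_in: "\<alpha> \<in> Arr C \<Longrightarrow> Dom C \<alpha> \<in> Obj C"
    and Cod_in: "\<alpha> \<in> Arr C \<Longrightarrow> Cod C \<alpha> \<in> Obj C"
    and Ident_in: "j \<in> Obj C \<Longrightarrow> Ident C j \<in> Arr C"
    and Dom_Ident: "j \<in> Obj C \<Longrightarrow> Dom C (Ident C j) = j"
    and Cod_Ident: "j \<in> Obj C \<Longrightarrow> Cod C (Ident C j) = j"
    and Comp_in: "\<lbrakk>\<alpha> \<in> Arr C; \<beta> \<in> Arr C; Dom C \<beta> = Cod C \<alpha>\<rbrakk> \<Longrightarrow> Comp C \<beta> \<alpha> \<in> Arr C"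
    and Dom_Comp: "\<lbrakk>\<alpha> \<in> Arr C; \<beta> \<in> Arr C; Dom C \<beta> = Cod C \<alpha>\<rbrakk> \<Longrightarrow> Dom C (Comp C \<beta> \<alpha>) = Dom C \<alpha>"
    and Cod_Comp: "\<lbrakk>\<alpha> \<in> Arr C; \<beta> \<in> Arr C; Dom C \<beta> = Cod C \<alpha>\<rbrakk> \<Longrightarrow> Cod C (Comp C \<beta> \<alpha>) = Cod C \<beta>"
    and Comp_Ident: "\<alpha> \<in> Arr C \<Longrightarrow> Comp C \<alpha> (Ident C (Dom C \<alpha>)) = \<alpha>"
    and Ident_Comp: "\<alpha> \<in> Arr C \<Longrightarrow> Comp C (Ident C (Cod C \<alpha>)) \<alpha> = \<alpha>"
    and Comp_assoc: "\<lbrakk>\<alpha> \<in> Arr C; \<beta> \<in> Arr C; \<gamma> \<in> Arr C; Dom C \<beta> = Cod C \<alpha>; Dom C \<gamma> = Cod C \<beta>\<rbrakk>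
      \<Longrightarrow> Comp C \<gamma> (Comp C \<beta> \<alpha>) = Comp C (Comp C \<gamma> \<beta>) \<alpha>"

text \<open>Functors from \<open>J\<close> to non-singular simplicial sets: \<open>F\<close> is the object part, \<open>Fm\<close> the
  morphism part.\<close>

definition ns_diagram ::
  "('o, 'm) cat \<Rightarrow> ('o \<Rightarrow> 'a sset) \<Rightarrow> ('m \<Rightarrow> nat \<Rightarrow> 'a \<Rightarrow> 'a) \<Rightarrow> bool" where
  "ns_diagram J F Fm \<longleftrightarrow>
     (\<forall>j\<in>Obj J. nonsingular (F j)) \<and>
     (\<forall>\<alpha>\<in>Arr J. simplicial_map (F (Dom J \<alpha>)) (F (Cod J \<alpha>)) (Fm \<alpha>)) \<and>
     (\<forall>j\<in>Obj J. Fm (Ident J j) = smap_id (F j)) \<and>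
     (\<forall>\<alpha>\<in>Arr J. \<forall>\<beta>\<in>Arr J. Dom J \<beta> = Cod J \<alpha> \<longrightarrow>
        Fm (Comp J \<beta> \<alpha>) = smap_comp (F (Dom J \<alpha>)) (Fm \<beta>) (Fm \<alpha>))"

definition ns_cocone ::
  "('o, 'm) cat \<Rightarrow> ('o \<Rightarrow> 'a sset) \<Rightarrow> ('m \<Rightarrow> nat \<Rightarrow> 'a \<Rightarrow> 'a) \<Rightarrow>
   'b sset \<Rightarrow> ('o \<Rightarrow> nat \<Rightarrow> 'a \<Rightarrow> 'b) \<Rightarrow> bool" where
  "ns_cocone J F Fm T \<tau> \<longleftrightarrow>
     nonsingular T \<and>
     (\<forall>j\<in>Obj J. simplicial_map (F j) T (\<tau> j)) \<and>
     (\<forall>\<alpha>\<in>Arr J. smap_comp (F (Dom J \<alpha>)) (\<tau> (Cod J \<alpha>)) (Fm \<alpha>) = \<tau> (Dom J \<alpha>))"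

text \<open>The cocone \<open>\<iota>\<close> to \<open>L\<close> is universal among the cocones to non-singular simplicial sets. HOL
  formulas cannot quantify over types, so the type \<open>'t\<close> of the simplices of the competing cocones
  is a parameter; a colimit in the usual sense is one for all \<open>'t\<close>. A cocone is jointly surjective
  onto a non-singular simplicial subset of its target. Hence, if \<open>'u\<close> is infinite, the simplices of
  \<open>L\<close> and of all \<open>F j\<close> lie in \<open>'u\<close>, and \<open>J\<close> has at most \<open>|'u|\<close> objects, then universality for
  \<open>'t = 'u\<close> already implies universality for every \<open>'t\<close>.\<close>

definition ns_colimit ::
  "'t itself \<Rightarrow> ('o, 'm) cat \<Rightarrow> ('o \<Rightarrow> 'a sset) \<Rightarrow> ('m \<Rightarrow> nat \<Rightarrow> 'a \<Rightarrow> 'a) \<Rightarrow>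
   'b sset \<Rightarrow> ('o \<Rightarrow> nat \<Rightarrow> 'a \<Rightarrow> 'b) \<Rightarrow> bool" where
  "ns_colimit _ J F Fm L \<iota> \<longleftrightarrow>
     ns_diagram J F Fm \<and> ns_cocone J F Fm L \<iota> \<and>
     (\<forall>(T :: 't sset) \<tau>. ns_cocone J F Fm T \<tau> \<longrightarrow>
        (\<exists>!u. simplicial_map L T u \<and> (\<forall>j\<in>Obj J. smap_comp (F j) u (\<iota> j) = \<tau> j)))"

end

theory Submission
  imports Defs
begin

text \<open>The functor \<open>X \<mapsto> X \<times> K\<close> has a right adjoint on non-singular simplicial sets, namely the usual
  internal hom \<open>T \<mapsto> T\<^sup>K\<close> of simplicial sets, whose \<open>n\<close>-simplices are the maps
  \<open>\<Delta>[n] \<times> K \<rightarrow> T\<close>. The point is that \<open>T\<^sup>K\<close> is non-singular as soon as \<open>T\<close> is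
  (\<open>nonsingular_internal_hom\<close>); after that, a cocone \<open>F j \<times> K \<rightarrow> T\<close> is transposed to a cocone
  \<open>F j \<rightarrow> T\<^sup>K\<close>, which factors through \<open>L\<close>, and the factorization \<open>L \<rightarrow> T\<^sup>K\<close> is transposed back to
  \<open>L \<times> K \<rightarrow> T\<close>.

  Why \<open>T\<^sup>K\<close> is non-singular: a simplicial set is non-singular exactly when every simplex whose
  vertices \<open>a < b\<close> coincide is unchanged by collapsing the whole interval from \<open>a\<close> to \<open>b\<close> to
  \<open>a\<close> (\<open>nonsingular_iff_collapse\<close>). For \<open>g : \<Delta>[n] \<times> K \<rightarrow> T\<close> with equal restrictions to
  \<open>{a} \<times> K\<close> and \<open>{b} \<times> K\<close>, one has to see that \<open>g(\<theta>, k)\<close> does not change if the values of \<open>\<theta>\<close>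
  between \<open>a\<close> and \<open>b\<close> are replaced by \<open>a\<close>. They are replaced one at a time. Two consecutive stages
  are faces of a simplex of one dimension more, as in the triangulation of a prism, and in that
  simplex the edge joining the old vertex to the new one is sent by \<open>g\<close> to an edge with equal end
  points. In the non-singular \<open>T\<close> the simplex is then degenerate along this edge, so that the two faces
  agree (\<open>collapse_first_factor\<close>).

  It remains to deal with universes, because \<open>L\<close> is universal only for cocones with simplices in
  \<open>'u\<close>, and the simplices of \<open>T\<^sup>K\<close> are functions that may form a larger set. A cocone factors through
  the union of the images of its components, which has at most as many simplices as \<open>'u\<close> has
  elements and can therefore be moved into \<open>'u\<close> (\<open>ns_colimit_factorization\<close>). The same image, formed
  inside \<open>L\<close>, shows that the colimit cocone is jointly surjective
  (\<open>ns_colimit_jointly_surjective\<close>); this property passes to the product with \<open>K\<close> and yields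
  uniqueness.\<close>

section \<open>Order maps, vertices and simplicial maps\<close>

definition point :: "nat \<Rightarrow> nat \<Rightarrow> nat" where
  "point i = (\<lambda>_\<in>{..0}. i)"

definition vertex :: "'a sset \<Rightarrow> nat \<Rightarrow> 'a \<Rightarrow> nat \<Rightarrow> 'a" where
  "vertex X n x i = act X 0 n (point i) x"

lemma ord_maps_iff:
  "\<theta> \<in> ord_maps m n \<longleftrightarrow>
    \<theta> \<in> extensional {..m} \<and> (\<forall>i\<le>m. \<theta> i \<le> n) \<and> (\<forall>i j. i \<le> j \<longrightarrow> j \<le> m \<longrightarrow> \<theta> i \<le> \<theta> j)"
  by (auto simp: ord_maps_def PiE_def Pi_def mono_on_def)

lemma ord_maps_le: "\<theta> \<in> ord_maps m n \<Longrightarrow> i \<le> m \<Longrightarrow> \<theta> i \<le> n"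
  by (simp add: ord_maps_iff)

lemma ord_maps_mono: "\<theta> \<in> ord_maps m n \<Longrightarrow> i \<le> j \<Longrightarrow> j \<le> m \<Longrightarrow> \<theta> i \<le> \<theta> j"
  by (simp add: ord_maps_iff)

lemma ord_maps_eqI:
  "\<theta> \<in> ord_maps m n \<Longrightarrow> \<phi> \<in> ord_maps m n' \<Longrightarrow> (\<And>i. i \<le> m \<Longrightarrow> \<theta> i = \<phi> i) \<Longrightarrow> \<theta> = \<phi>"
  by (auto simp: ord_maps_iff intro: extensionalityI)

lemma restrict_in_ord_maps:
  assumes "\<And>i. i \<le> m \<Longrightarrow> f i \<le> n" and "\<And>i j. i \<le> j \<Longrightarrow> j \<le> m \<Longrightarrow> f i \<le> f j"
  shows "restrict f {..m} \<in> ord_maps m n"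
  using assms by (auto simp: ord_maps_iff)

lemma id_in_ord_maps: "(\<lambda>i\<in>{..n}. i) \<in> ord_maps n n"
  by (rule restrict_in_ord_maps) auto

lemma point_in_ord_maps: "i \<le> n \<Longrightarrow> point i \<in> ord_maps 0 n"
  unfolding point_def by (rule restrict_in_ord_maps) auto

lemma compose_in_ord_maps:
  assumes "\<theta> \<in> ord_maps m n" and "\<phi> \<in> ord_maps l m"
  shows "compose {..l} \<theta> \<phi> \<in> ord_maps l n"
  using assms unfolding compose_def by (intro restrict_in_ord_maps) (auto simp: ord_maps_iff)

lemma compose_assoc_ord_maps:
  assumes "\<psi> \<in> ord_maps l m"
  shows "compose {..l} \<theta> (compose {..l} \<phi> \<psi>) = compose {..l} (compose {..m} \<theta> \<phi>) \<psi>"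
  using assms by (auto simp: compose_def fun_eq_iff ord_maps_iff)

lemma compose_id_left:
  assumes "\<theta> \<in> ord_maps m n"
  shows "compose {..m} (\<lambda>i\<in>{..n}. i) \<theta> = \<theta>"
  by (rule ord_maps_eqI[OF compose_in_ord_maps[OF id_in_ord_maps assms] assms])
     (use assms in \<open>auto simp: compose_def ord_maps_iff\<close>)

lemma compose_id_right:
  assumes "\<theta> \<in> ord_maps m n"
  shows "compose {..m} \<theta> (\<lambda>i\<in>{..m}. i) = \<theta>"
  by (rule ord_maps_eqI[OF compose_in_ord_maps[OF assms id_in_ord_maps] assms])
     (auto simp: compose_def)

lemma compose_point: "compose {0} \<theta> (point i) = point (\<theta> i)"
  by (auto simp: compose_def point_def)

lemma act_in:
  "simplicial_set X \<Longrightarrow> \<theta> \<in> ord_maps m n \<Longrightarrow> x \<in> smp X n \<Longrightarrow> act X m n \<theta> x \<in> smp X m"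
  by (auto simp: simplicial_set_def)

lemma act_id: "simplicial_set X \<Longrightarrow> x \<in> smp X n \<Longrightarrow> act X n n (\<lambda>i\<in>{..n}. i) x = x"
  by (auto simp: simplicial_set_def)

lemma act_compose:
  "simplicial_set X \<Longrightarrow> \<phi> \<in> ord_maps l m \<Longrightarrow> \<theta> \<in> ord_maps m n \<Longrightarrow> x \<in> smp X n \<Longrightarrow>
    act X l n (compose {..l} \<theta> \<phi>) x = act X l m \<phi> (act X m n \<theta> x)"
  by (auto simp: simplicial_set_def)

lemma simplicial_setI:
  assumes "\<And>m n \<theta> x. \<theta> \<in> ord_maps m n \<Longrightarrow> x \<in> smp X n \<Longrightarrow> act X m n \<theta> x \<in> smp X m"
    and "\<And>n x. x \<in> smp X n \<Longrightarrow> act X n n (\<lambda>i\<in>{..n}. i) x = x"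
    and "\<And>l m n \<phi> \<theta> x. \<phi> \<in> ord_maps l m \<Longrightarrow> \<theta> \<in> ord_maps m n \<Longrightarrow> x \<in> smp X n \<Longrightarrow>
      act X l n (compose {..l} \<theta> \<phi>) x = act X l m \<phi> (act X m n \<theta> x)"
  shows "simplicial_set X"
  using assms by (auto simp: simplicial_set_def)

lemma vertex_act:
  assumes "simplicial_set X" and "\<theta> \<in> ord_maps m n" and "x \<in> smp X n" and "i \<le> m"
  shows "vertex X m (act X m n \<theta> x) i = vertex X n x (\<theta> i)"
  using act_compose[OF assms(1) point_in_ord_maps[OF assms(4)] assms(2,3)]
  by (simp add: vertex_def compose_point)

lemma simplicial_mapI:
  assumes "\<And>n x. x \<in> smp X n \<Longrightarrow> f n x \<in> smp Y n"
    and "\<And>n x. x \<notin> smp X n \<Longrightarrow> f n x = undefined"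
    and "\<And>m n \<theta> x. \<theta> \<in> ord_maps m n \<Longrightarrow> x \<in> smp X n \<Longrightarrow> f m (act X m n \<theta> x) = act Y m n \<theta> (f n x)"
  shows "simplicial_map X Y f"
  using assms by (auto simp: simplicial_map_def)

lemma simplicial_map_in: "simplicial_map X Y f \<Longrightarrow> x \<in> smp X n \<Longrightarrow> f n x \<in> smp Y n"
  by (auto simp: simplicial_map_def)

lemma simplicial_map_undefined: "simplicial_map X Y f \<Longrightarrow> x \<notin> smp X n \<Longrightarrow> f n x = undefined"
  by (force simp: simplicial_map_def PiE_def extensional_def)

lemma simplicial_map_act:
  "simplicial_map X Y f \<Longrightarrow> \<theta> \<in> ord_maps m n \<Longrightarrow> x \<in> smp X n \<Longrightarrow>
    f m (act X m n \<theta> x) = act Y m n \<theta> (f n x)"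
  by (auto simp: simplicial_map_def)

lemma simplicial_map_eqI:
  assumes "simplicial_map X Y f" and "simplicial_map X Z g"
    and "\<And>n x. x \<in> smp X n \<Longrightarrow> f n x = g n x"
  shows "f = g"
proof (intro ext)
  fix n x
  show "f n x = g n x"
    by (cases "x \<in> smp X n")
       (simp_all add: assms(3) simplicial_map_undefined[OF assms(1)] simplicial_map_undefined[OF assms(2)])
qed

lemma simplicial_map_smap_id: "simplicial_set X \<Longrightarrow> simplicial_map X X (smap_id X)"
  by (rule simplicial_mapI) (auto simp: smap_id_def act_in)

lemma smap_comp_apply: "x \<in> smp X n \<Longrightarrow> smap_comp X g f n x = g n (f n x)"
  by (simp add: smap_comp_def compose_def)

lemma simplicial_map_smap_comp:
  assumes X: "simplicial_set X" and f: "simplicial_map X Y f" and g: "simplicial_map Y Z g"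
  shows "simplicial_map X Z (smap_comp X g f)"
proof (rule simplicial_mapI)
  fix n x
  show "smap_comp X g f n x \<in> smp Z n" if "x \<in> smp X n"
    using that simplicial_map_in[OF f that] by (simp add: smap_comp_apply simplicial_map_in[OF g])
  show "smap_comp X g f n x = undefined" if "x \<notin> smp X n"
    using that by (simp add: smap_comp_def compose_def)
next
  fix m n \<theta> x
  assume "\<theta> \<in> ord_maps m n" and "x \<in> smp X n"
  then show "smap_comp X g f m (act X m n \<theta> x) = act Z m n \<theta> (smap_comp X g f n x)"
    using act_in[OF X] simplicial_map_in[OF f]
    by (simp add: smap_comp_apply simplicial_map_act[OF f] simplicial_map_act[OF g])
qed

lemma smp_prod [simp]: "smp (X \<times>\<^sub>s Y) n = smp X n \<times> smp Y n"
  by (simp add: sset_prod_def)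

lemma act_prod [simp]: "act (X \<times>\<^sub>s Y) m n \<theta> (x, y) = (act X m n \<theta> x, act Y m n \<theta> y)"
  by (simp add: sset_prod_def)

lemma smp_std_simplex [simp]: "smp (std_simplex n) m = ord_maps m n"
  by (simp add: std_simplex_def)

lemma act_std_simplex [simp]: "act (std_simplex n) l m \<phi> \<theta> = compose {..l} \<theta> \<phi>"
  by (simp add: std_simplex_def)

lemma simplicial_set_prod:
  assumes "simplicial_set X" and "simplicial_set Y"
  shows "simplicial_set (X \<times>\<^sub>s Y)"
  using assms by (intro simplicial_setI) (auto simp: act_in act_id act_compose)

section \<open>Non-singularity in terms of vertices\<close>

definition collapse :: "nat \<Rightarrow> nat \<Rightarrow> nat \<Rightarrow> nat \<Rightarrow> nat" where
  "collapse n a b = (\<lambda>i\<in>{..n}. if a \<le> i \<and> i \<le> b then a else i)"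

lemma collapse_in_ord_maps: "a \<le> n \<Longrightarrow> collapse n a b \<in> ord_maps n n"
  unfolding collapse_def by (rule restrict_in_ord_maps) auto

text \<open>The existence half of the Eilenberg--Zilber lemma: the dimension drops whenever a simplex is
  written as a degeneracy, so this can be repeated only finitely often.\<close>

lemma nondegenerate_factorization:
  assumes X: "simplicial_set X" and "x \<in> smp X n"
  shows "\<exists>m \<eta> y. \<eta> \<in> ord_maps n m \<and> y \<in> smp X m \<and> \<not> degenerate X m y \<and> x = act X n m \<eta> y"
  using assms(2)
proof (induction n arbitrary: x rule: less_induct)
  case (less n)
  show ?case
  proof (cases "degenerate X n x")
    case False
    then show ?thesis
      using less.prems act_id[OF X less.prems] id_in_ord_maps by metis
  next
    case True
    then obtain m \<theta> y where "m < n" and \<theta>: "\<theta> \<in> ord_maps n m" and y: "y \<in> smp X m"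
      and x: "x = act X n m \<theta> y"
      unfolding degenerate_def by blast
    from less.IH[OF \<open>m < n\<close> y] obtain k \<eta> z where \<eta>: "\<eta> \<in> ord_maps m k" and z: "z \<in> smp X k"
      and "\<not> degenerate X k z" and "y = act X m k \<eta> z"
      by blast
    moreover from this have "x = act X n k (compose {..n} \<eta> \<theta>) z"
      using act_compose[OF X \<theta> \<eta> z] x by simp
    ultimately show ?thesis
      using compose_in_ord_maps[OF \<eta> \<theta>] by blast
  qed
qed

text \<open>In degree \<open>0\<close>, injectivity of the representing map says that the vertices of a non-degenerate
  simplex are pairwise distinct. Hence the order map \<open>\<eta>\<close> of an Eilenberg--Zilber factorization
  \<open>x = \<eta>\<^sup>* y\<close> identifies two positions precisely when \<open>x\<close> has the same vertex there.\<close>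

lemma nonsingular_factorization:
  assumes X: "nonsingular X" and x: "x \<in> smp X n"
  obtains m \<eta> y where "\<eta> \<in> ord_maps n m" and "y \<in> smp X m" and "x = act X n m \<eta> y"
    and "\<And>a b. a \<le> n \<Longrightarrow> b \<le> n \<Longrightarrow> vertex X n x a = vertex X n x b \<longleftrightarrow> \<eta> a = \<eta> b"
proof -
  have ss: "simplicial_set X"
    using X by (simp add: nonsingular_def)
  obtain m \<eta> y where \<eta>: "\<eta> \<in> ord_maps n m" and y: "y \<in> smp X m"
    and "\<not> degenerate X m y" and xy: "x = act X n m \<eta> y"
    using nondegenerate_factorization[OF ss x] by blast
  then have "inj_on (rep_map X m y 0) (smp (std_simplex m) 0)"
    using X by (auto simp: nonsingular_def)
  then have inj: "inj_on (\<lambda>\<theta>. act X 0 m \<theta> y) (ord_maps 0 m)"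
    by (simp add: rep_map_def inj_on_def)
  have "vertex X n x a = vertex X n x b \<longleftrightarrow> \<eta> a = \<eta> b" if "a \<le> n" "b \<le> n" for a b
  proof -
    have "vertex X n x a = vertex X n x b \<longleftrightarrow>
        act X 0 m (point (\<eta> a)) y = act X 0 m (point (\<eta> b)) y"
      unfolding xy using vertex_act[OF ss \<eta> y] that by (simp add: vertex_def)
    also have "\<dots> \<longleftrightarrow> point (\<eta> a) = point (\<eta> b)"
      using inj_on_eq_iff[OF inj] point_in_ord_maps ord_maps_le[OF \<eta>] that by simp
    also have "\<dots> \<longleftrightarrow> \<eta> a = \<eta> b"
      by (metis atMost_iff le_refl point_def restrict_apply')
    finally show ?thesis .
  qed
  with \<eta> y xy show thesis
    by (rule that)
qed

text \<open>This form of non-singularity consists of equations between simplices of \<open>X\<close> that are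
  conditional on further such equations. It mentions neither degeneracy nor non-degenerate simplices,
  so it passes to products and to subobjects.

  From left to right, \<open>\<eta>\<close> in \<open>x = \<eta>\<^sup>* y\<close> is monotone with \<open>\<eta> a = \<eta> b\<close>, hence constant between
  \<open>a\<close> and \<open>b\<close>. From right to left, two simplices of \<open>\<Delta>[n]\<close> that are not separated by \<open>x\<close> give
  two equal vertices \<open>a < b\<close> of \<open>x\<close>, and collapsing from \<open>a\<close> to \<open>b\<close> then exhibits \<open>x\<close> as
  degenerate.\<close>

lemma nonsingular_iff_collapse:
  "nonsingular X \<longleftrightarrow> simplicial_set X \<and>
    (\<forall>n. \<forall>x\<in>smp X n. \<forall>a b. a < b \<longrightarrow> b \<le> n \<longrightarrow> vertex X n x a = vertex X n x b \<longrightarrow>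
      act X n n (collapse n a b) x = x)"
  (is "_ \<longleftrightarrow> _ \<and> ?collapsing")
proof (intro iffI conjI allI ballI impI)
  assume X: "nonsingular X"
  then show ss: "simplicial_set X"
    by (simp add: nonsingular_def)
  fix n x a b
  assume x: "x \<in> smp X n" and ab: "a < b" "b \<le> n" and eq: "vertex X n x a = vertex X n x b"
  obtain m \<eta> y where \<eta>: "\<eta> \<in> ord_maps n m" and y: "y \<in> smp X m" and xy: "x = act X n m \<eta> y"
    and "\<And>a b. a \<le> n \<Longrightarrow> b \<le> n \<Longrightarrow> vertex X n x a = vertex X n x b \<longleftrightarrow> \<eta> a = \<eta> b"
    by (rule nonsingular_factorization[OF X x]) blast
  then have \<eta>ab: "\<eta> a = \<eta> b"
    using eq ab by simp
  have c: "collapse n a b \<in> ord_maps n n"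
    using ab by (simp add: collapse_in_ord_maps)
  have "compose {..n} \<eta> (collapse n a b) = \<eta>"
  proof (rule ord_maps_eqI[OF compose_in_ord_maps[OF \<eta> c] \<eta>])
    fix i assume "i \<le> n"
    moreover have "\<eta> a = \<eta> i" if "a \<le> i" "i \<le> b"
      using ord_maps_mono[OF \<eta>, of a i] ord_maps_mono[OF \<eta>, of i b] that ab \<eta>ab by simp
    ultimately show "compose {..n} \<eta> (collapse n a b) i = \<eta> i"
      by (simp add: compose_def collapse_def)
  qed
  then show "act X n n (collapse n a b) x = x"
    unfolding xy using act_compose[OF ss c \<eta> y] by simp
next
  assume "simplicial_set X \<and> ?collapsing"
  then have X: "simplicial_set X" and W: ?collapsing
    by auto
  show "nonsingular X"
    unfolding nonsingular_def
  proof (intro conjI X allI ballI impI)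
    fix n x m
    assume x: "x \<in> smp X n" and nd: "\<not> degenerate X n x"
    show "inj_on (rep_map X n x m) (smp (std_simplex n) m)"
    proof (rule ccontr)
      assume "\<not> ?thesis"
      then obtain \<alpha> \<beta> where \<alpha>: "\<alpha> \<in> ord_maps m n" and \<beta>: "\<beta> \<in> ord_maps m n"
        and "act X m n \<alpha> x = act X m n \<beta> x" and "\<alpha> \<noteq> \<beta>"
        by (auto simp: inj_on_def rep_map_def)
      then obtain i where i: "i \<le> m" "\<alpha> i \<noteq> \<beta> i"
        using ord_maps_eqI by blast
      have "vertex X n x (\<alpha> i) = vertex X n x (\<beta> i)"
        using vertex_act[OF X \<alpha> x i(1)] vertex_act[OF X \<beta> x i(1)]
          \<open>act X m n \<alpha> x = act X m n \<beta> x\<close> by simp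
      then obtain a b where ab: "a < b" "b \<le> n" and "vertex X n x a = vertex X n x b"
        using ord_maps_le[OF \<alpha> i(1)] ord_maps_le[OF \<beta> i(1)] i(2) by (metis linorder_neqE_nat)
      then have cx: "act X n n (collapse n a b) x = x"
        using W x by blast
      \<comment> \<open>The degeneracy operator merging \<open>a\<close> and \<open>a + 1\<close>, and the face operator omitting
        \<open>a + 1\<close>, which is a section of it. Collapsing absorbs \<open>\<delta>\<sigma>\<close>, because \<open>\<delta>\<sigma>\<close> moves only
        \<open>a + 1\<close>, to \<open>a\<close>, and \<open>a + 1 \<le> b\<close>.\<close>
      define \<sigma> where "\<sigma> = (\<lambda>i\<in>{..n}. if i \<le> a then i else i - 1)"
      define \<delta> where "\<delta> = (\<lambda>i\<in>{..n - 1}. if i \<le> a then i else i + 1)"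
      have \<sigma>: "\<sigma> \<in> ord_maps n (n - 1)" and \<delta>: "\<delta> \<in> ord_maps (n - 1) n"
        unfolding \<sigma>_def \<delta>_def using ab by (auto intro!: restrict_in_ord_maps)
      have c: "collapse n a b \<in> ord_maps n n"
        using ab by (simp add: collapse_in_ord_maps)
      have surj: "\<sigma> ` {..n} = {..n - 1}"
      proof
        show "\<sigma> ` {..n} \<subseteq> {..n - 1}"
          using ord_maps_le[OF \<sigma>] by auto
        show "{..n - 1} \<subseteq> \<sigma> ` {..n}"
        proof
          fix i assume "i \<in> {..n - 1}"
          then have "i = \<sigma> (\<delta> i)" and "\<delta> i \<in> {..n}"
            using ab by (auto simp: \<sigma>_def \<delta>_def)
          then show "i \<in> \<sigma> ` {..n}"
            by blast
        qed
      qed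
      have "compose {..n} (collapse n a b) (compose {..n} \<delta> \<sigma>) = collapse n a b"
        by (rule ord_maps_eqI[OF compose_in_ord_maps[OF c compose_in_ord_maps[OF \<delta> \<sigma>]] c])
           (use ab in \<open>auto simp: compose_def \<sigma>_def \<delta>_def collapse_def\<close>)
      then have "x = act X n n (compose {..n} \<delta> \<sigma>) x"
        using act_compose[OF X compose_in_ord_maps[OF \<delta> \<sigma>] c x] cx by simp
      also have "\<dots> = act X n (n - 1) \<sigma> (act X (n - 1) n \<delta> x)"
        by (rule act_compose[OF X \<sigma> \<delta> x])
      finally have "degenerate X n x"
        unfolding degenerate_def using \<sigma> surj act_in[OF X \<delta> x] ab by (intro exI[of _ "n - 1"]) auto
      with nd show False ..
    qed
  qed
qed

lemma nonsingular_simplicial_set: "nonsingular X \<Longrightarrow> simplicial_set X"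
  by (simp add: nonsingular_def)

lemma nonsingular_collapse:
  "nonsingular X \<Longrightarrow> x \<in> smp X n \<Longrightarrow> a < b \<Longrightarrow> b \<le> n \<Longrightarrow> vertex X n x a = vertex X n x b \<Longrightarrow>
    act X n n (collapse n a b) x = x"
  by (simp add: nonsingular_iff_collapse)

lemma nonsingular_embedding:
  assumes X: "simplicial_set X" and Y: "nonsingular Y" and f: "simplicial_map X Y f"
    and inj: "\<And>n. inj_on (f n) (smp X n)"
  shows "nonsingular X"
  unfolding nonsingular_iff_collapse
proof (intro conjI X allI ballI impI)
  fix n x a b
  assume x: "x \<in> smp X n" and ab: "a < b" "b \<le> n" and "vertex X n x a = vertex X n x b"
  then have "vertex Y n (f n x) a = vertex Y n (f n x) b"
    unfolding vertex_def
    by (metis simplicial_map_act[OF f] point_in_ord_maps less_imp_le order_trans x)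
  then have "act Y n n (collapse n a b) (f n x) = f n x"
    using nonsingular_collapse[OF Y simplicial_map_in[OF f x] ab] by simp
  moreover have c: "collapse n a b \<in> ord_maps n n"
    using ab by (simp add: collapse_in_ord_maps)
  ultimately have "f n (act X n n (collapse n a b) x) = f n x"
    by (simp add: simplicial_map_act[OF f _ x])
  then show "act X n n (collapse n a b) x = x"
    using inj_on_eq_iff[OF inj] act_in[OF X c x] x by blast
qed

lemma nonsingular_prod:
  assumes "nonsingular X" and "nonsingular Y"
  shows "nonsingular (X \<times>\<^sub>s Y)"
  using assms unfolding nonsingular_iff_collapse
  by (auto simp: simplicial_set_prod vertex_def)

section \<open>Internal homs\<close>

text \<open>The exponential \<open>T\<^sup>K\<close>: an order map \<open>\<theta> : [m] \<rightarrow> [n]\<close> acts by precomposition with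
  \<open>\<theta>\<^sub>* \<times> id : \<Delta>[m] \<times> K \<rightarrow> \<Delta>[n] \<times> K\<close>.\<close>

definition internal_hom :: "'k sset \<Rightarrow> 't sset \<Rightarrow> (nat \<Rightarrow> (nat \<Rightarrow> nat) \<times> 'k \<Rightarrow> 't) sset" where
  "internal_hom K T =
    \<lparr>smp = (\<lambda>n. {g. simplicial_map (std_simplex n \<times>\<^sub>s K) T g}),
     act = (\<lambda>m n \<theta> g. \<lambda>l. \<lambda>p\<in>smp (std_simplex m \<times>\<^sub>s K) l. g l (compose {..l} \<theta> (fst p), snd p))\<rparr>"

lemma smp_internal_hom [simp]:
  "g \<in> smp (internal_hom K T) n \<longleftrightarrow> simplicial_map (std_simplex n \<times>\<^sub>s K) T g"
  by (simp add: internal_hom_def)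

lemma act_internal_hom:
  "\<phi> \<in> ord_maps l m \<Longrightarrow> k \<in> smp K l \<Longrightarrow>
    act (internal_hom K T) m n \<theta> g l (\<phi>, k) = g l (compose {..l} \<theta> \<phi>, k)"
  by (simp add: internal_hom_def)

lemma simplicial_map_on_std_prod:
  assumes g: "simplicial_map (std_simplex n \<times>\<^sub>s K) T g" and "\<theta> \<in> ord_maps m n" and "k \<in> smp K m"
    and "\<phi> \<in> ord_maps l m"
  shows "act T l m \<phi> (g m (\<theta>, k)) = g l (compose {..l} \<theta> \<phi>, act K l m \<phi> k)"
  using simplicial_map_act[OF g, of \<phi> l m "(\<theta>, k)"] assms(2-4) by simp

lemma act_internal_hom_in:
  assumes K: "simplicial_set K" and \<theta>: "\<theta> \<in> ord_maps m n"
    and g: "simplicial_map (std_simplex n \<times>\<^sub>s K) T g"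
  shows "simplicial_map (std_simplex m \<times>\<^sub>s K) T (act (internal_hom K T) m n \<theta> g)"
proof (rule simplicial_mapI)
  fix l p
  assume "p \<in> smp (std_simplex m \<times>\<^sub>s K) l"
  then show "act (internal_hom K T) m n \<theta> g l p \<in> smp T l"
    using compose_in_ord_maps[OF \<theta>] simplicial_map_in[OF g]
    by (auto simp: act_internal_hom)
next
  fix l p
  assume "p \<notin> smp (std_simplex m \<times>\<^sub>s K) l"
  then show "act (internal_hom K T) m n \<theta> g l p = undefined"
    by (auto simp: internal_hom_def)
next
  fix l q \<phi> p
  assume \<phi>: "\<phi> \<in> ord_maps l q" and "p \<in> smp (std_simplex m \<times>\<^sub>s K) q"
  then obtain \<psi> k where p: "p = (\<psi>, k)" and \<psi>: "\<psi> \<in> ord_maps q m" and k: "k \<in> smp K q"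
    by auto
  show "act (internal_hom K T) m n \<theta> g l (act (std_simplex m \<times>\<^sub>s K) l q \<phi> p) =
      act T l q \<phi> (act (internal_hom K T) m n \<theta> g q p)"
    unfolding p using \<phi> \<psi> k
    by (simp add: act_internal_hom compose_in_ord_maps act_in[OF K] compose_assoc_ord_maps
        simplicial_map_on_std_prod[OF g compose_in_ord_maps[OF \<theta>]])
qed

lemma simplicial_set_internal_hom:
  assumes K: "simplicial_set K"
  shows "simplicial_set (internal_hom K T)"
proof (rule simplicial_setI)
  fix m n \<theta> and g :: "nat \<Rightarrow> (nat \<Rightarrow> nat) \<times> 'a \<Rightarrow> 'b"
  assume \<theta>: "\<theta> \<in> ord_maps m n" and g: "g \<in> smp (internal_hom K T) n"
  then show "act (internal_hom K T) m n \<theta> g \<in> smp (internal_hom K T) m"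
    by (simp add: act_internal_hom_in[OF K])
next
  fix n and g :: "nat \<Rightarrow> (nat \<Rightarrow> nat) \<times> 'a \<Rightarrow> 'b"
  assume "g \<in> smp (internal_hom K T) n"
  then have g: "simplicial_map (std_simplex n \<times>\<^sub>s K) T g"
    by simp
  show "act (internal_hom K T) n n (\<lambda>i\<in>{..n}. i) g = g"
    by (rule simplicial_map_eqI[OF act_internal_hom_in[OF K id_in_ord_maps g] g])
       (auto simp: act_internal_hom compose_id_left)
next
  fix l m n \<phi> \<theta> and g :: "nat \<Rightarrow> (nat \<Rightarrow> nat) \<times> 'a \<Rightarrow> 'b"
  assume \<phi>: "\<phi> \<in> ord_maps l m" and \<theta>: "\<theta> \<in> ord_maps m n" and "g \<in> smp (internal_hom K T) n"
  then have g: "simplicial_map (std_simplex n \<times>\<^sub>s K) T g"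
    by simp
  show "act (internal_hom K T) l n (compose {..l} \<theta> \<phi>) g =
      act (internal_hom K T) l m \<phi> (act (internal_hom K T) m n \<theta> g)"
    by (rule simplicial_map_eqI[OF act_internal_hom_in[OF K compose_in_ord_maps[OF \<theta> \<phi>] g]
          act_internal_hom_in[OF K \<phi> act_internal_hom_in[OF K \<theta> g]]])
       (auto simp: act_internal_hom compose_in_ord_maps[OF \<phi>] compose_assoc_ord_maps)
qed

lemma vertex_on_std_prod:
  assumes g: "simplicial_map (std_simplex n \<times>\<^sub>s K) T g"
    and "\<theta> \<in> ord_maps m n" and "k \<in> smp K m" and "i \<le> m"
  shows "vertex T m (g m (\<theta>, k)) i = g 0 (point (\<theta> i), vertex K m k i)"
  using simplicial_map_on_std_prod[OF assms(1-3) point_in_ord_maps[OF assms(4)]]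
  by (simp add: vertex_def compose_point)

text \<open>The map \<open>g\<close> restricted to \<open>\<Delta>[n] \<times> {v}\<close> is an \<open>n\<close>-simplex of \<open>T\<close>. An order map out of
  \<open>[n]\<close> encodes which of its vertices agree, and such a map, being monotone, cannot take the same
  value at \<open>a\<close> and \<open>b\<close> without being constant in between.\<close>

lemma vertices_between_agree:
  assumes K: "simplicial_set K" and T: "nonsingular T"
    and g: "simplicial_map (std_simplex n \<times>\<^sub>s K) T g" and v: "v \<in> smp K 0"
    and ac: "a \<le> c" "c \<le> b" "b \<le> n" and eq: "g 0 (point a, v) = g 0 (point b, v)"
  shows "g 0 (point c, v) = g 0 (point a, v)"
proof -
  \<comment> \<open>The totally degenerate \<open>n\<close>-simplex on the vertex \<open>v\<close>.\<close>
  define \<kappa> where "\<kappa> = (\<lambda>i\<in>{..n}. 0::nat)"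
  have \<kappa>: "\<kappa> \<in> ord_maps n 0"
    unfolding \<kappa>_def by (rule restrict_in_ord_maps) auto
  define k where "k = act K n 0 \<kappa> v"
  have k: "k \<in> smp K n"
    unfolding k_def by (rule act_in[OF K \<kappa> v])
  have kv: "vertex K n k i = v" if "i \<le> n" for i
  proof -
    have "vertex K n k i = act K 0 0 (point 0) v"
      unfolding k_def vertex_act[OF K \<kappa> v that] using that by (simp add: \<kappa>_def vertex_def)
    then show ?thesis
      using act_id[OF K v] by (simp add: point_def restrict_def cong: if_cong)
  qed
  let ?y = "g n ((\<lambda>i\<in>{..n}. i), k)"
  have y: "?y \<in> smp T n"
    using simplicial_map_in[OF g] id_in_ord_maps k by simp
  have vy: "vertex T n ?y i = g 0 (point i, v)" if "i \<le> n" for i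
    using vertex_on_std_prod[OF g id_in_ord_maps k that] kv[OF that] that by simp
  obtain m \<eta> z where \<eta>: "\<eta> \<in> ord_maps n m"
    and iff: "\<And>i j. i \<le> n \<Longrightarrow> j \<le> n \<Longrightarrow> vertex T n ?y i = vertex T n ?y j \<longleftrightarrow> \<eta> i = \<eta> j"
    by (rule nonsingular_factorization[OF T y]) blast
  have "\<eta> a = \<eta> b"
    using iff[of a b] vy eq ac by simp
  then have "\<eta> c = \<eta> a"
    using ord_maps_mono[OF \<eta> ac(1)] ord_maps_mono[OF \<eta> ac(2)] ac by simp
  then show ?thesis
    using iff[of c a] vy ac by simp
qed

text \<open>The two order maps are the cofaces omitting \<open>r\<close> and \<open>r + 1\<close>, and the second is the first
  followed by the map that sends \<open>r + 1\<close> to \<open>r\<close>, under which \<open>z\<close> is invariant.\<close>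

lemma faces_agree:
  assumes T: "nonsingular T" and z: "z \<in> smp T (Suc m)" and r: "r \<le> m"
    and eq: "vertex T (Suc m) z r = vertex T (Suc m) z (Suc r)"
  shows "act T m (Suc m) (\<lambda>l\<in>{..m}. if l < r then l else Suc l) z =
    act T m (Suc m) (\<lambda>l\<in>{..m}. if l \<le> r then l else Suc l) z"
    (is "act T m _ ?\<delta> z = act T m _ ?\<epsilon> z")
proof -
  let ?c = "collapse (Suc m) r (Suc r)"
  have ss: "simplicial_set T"
    by (rule nonsingular_simplicial_set[OF T])
  have c: "?c \<in> ord_maps (Suc m) (Suc m)"
    using r by (simp add: collapse_in_ord_maps)
  have \<delta>: "?\<delta> \<in> ord_maps m (Suc m)" and \<epsilon>: "?\<epsilon> \<in> ord_maps m (Suc m)"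
    by (auto intro!: restrict_in_ord_maps)
  have "compose {..m} ?c ?\<delta> = ?\<epsilon>"
    by (rule ord_maps_eqI[OF compose_in_ord_maps[OF c \<delta>] \<epsilon>])
       (auto simp: compose_def collapse_def)
  moreover have "act T (Suc m) (Suc m) ?c z = z"
    by (rule nonsingular_collapse[OF T z _ _ eq]) (use r in auto)
  ultimately show ?thesis
    using act_compose[OF ss \<delta> c z] by simp
qed

text \<open>The staircase argument. With \<open>\<theta>' = collapse \<circ> \<theta>\<close>, stage \<open>r\<close> is the order map
  \<open>\<theta>' 0 \<le> \<dots> \<le> \<theta>' (r - 1) \<le> \<theta> r \<le> \<dots> \<le> \<theta> m\<close>. It is monotone because collapsing never
  increases a value, which is why the replacement proceeds from left to right.\<close>

lemma collapse_first_factor: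
  assumes K: "simplicial_set K" and T: "nonsingular T"
    and g: "simplicial_map (std_simplex n \<times>\<^sub>s K) T g"
    and ab: "a < b" "b \<le> n"
    and eq: "\<And>v. v \<in> smp K 0 \<Longrightarrow> g 0 (point a, v) = g 0 (point b, v)"
    and \<theta>: "\<theta> \<in> ord_maps m n" and k: "k \<in> smp K m"
  shows "g m (compose {..m} (collapse n a b) \<theta>, k) = g m (\<theta>, k)"
proof -
  let ?c = "collapse n a b"
  have c: "?c \<in> ord_maps n n"
    using ab by (simp add: collapse_in_ord_maps)
  have c_le: "?c i \<le> i" if "i \<le> n" for i
    using that by (simp add: collapse_def)
  have c_mono: "?c i \<le> ?c j" if "i \<le> j" "j \<le> n" for i j
    using ord_maps_mono[OF c that] .
  have \<theta>n: "\<theta> i \<le> n" if "i \<le> m" for i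
    using ord_maps_le[OF \<theta> that] .
  have \<theta>m: "\<theta> i \<le> \<theta> j" if "i \<le> j" "j \<le> m" for i j
    using ord_maps_mono[OF \<theta> that] .
  have c\<theta>: "?c (\<theta> i) \<le> \<theta> j" if "i \<le> j" "j \<le> m" for i j
    using c_le[OF \<theta>n, of i] \<theta>m[OF that] that by simp
  define \<Theta> where "\<Theta> r = (\<lambda>l\<in>{..m}. if l < r then ?c (\<theta> l) else \<theta> l)" for r
  have step: "g m (\<Theta> (Suc r), k) = g m (\<Theta> r, k)" if r: "r \<le> m" for r
  proof -
    \<comment> \<open>The prism simplex \<open>\<theta>' 0 \<le> \<dots> \<le> \<theta>' r \<le> \<theta> r \<le> \<dots> \<le> \<theta> m\<close>, paired with the degeneracy of \<open>k\<close>
      that repeats vertex \<open>r\<close>. Omitting its vertex \<open>r\<close> gives stage \<open>r\<close>, and omitting \<open>r + 1\<close> gives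
      stage \<open>r + 1\<close>.\<close>
    define \<zeta> where "\<zeta> = (\<lambda>l\<in>{..Suc m}. if l \<le> r then ?c (\<theta> l) else \<theta> (l - 1))"
    define \<sigma> where "\<sigma> = (\<lambda>l\<in>{..Suc m}. if l \<le> r then l else l - 1)"
    have \<zeta>: "\<zeta> \<in> ord_maps (Suc m) n"
      unfolding \<zeta>_def
    proof (rule restrict_in_ord_maps)
      show "(if i \<le> r then ?c (\<theta> i) else \<theta> (i - 1)) \<le> n" if "i \<le> Suc m" for i
        using that r \<theta>n ord_maps_le[OF c \<theta>n] by auto
      show "(if i \<le> r then ?c (\<theta> i) else \<theta> (i - 1)) \<le> (if j \<le> r then ?c (\<theta> j) else \<theta> (j - 1))"
        if "i \<le> j" "j \<le> Suc m" for i j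
        using that r c\<theta>[of i "j - 1"] \<theta>m[of "i - 1" "j - 1"] c_mono[OF \<theta>m \<theta>n, of i j] by auto
    qed
    have \<sigma>: "\<sigma> \<in> ord_maps (Suc m) m"
      unfolding \<sigma>_def using r by (auto intro!: restrict_in_ord_maps)
    let ?k = "act K (Suc m) m \<sigma> k"
    let ?z = "g (Suc m) (\<zeta>, ?k)"
    have k': "?k \<in> smp K (Suc m)"
      by (rule act_in[OF K \<sigma> k])
    have z: "?z \<in> smp T (Suc m)"
      using simplicial_map_in[OF g] \<zeta> k' by simp
    have v: "vertex K m k r \<in> smp K 0"
      unfolding vertex_def by (rule act_in[OF K point_in_ord_maps[OF r] k])
    have vz: "vertex T (Suc m) ?z i = g 0 (point (\<zeta> i), vertex K m k (\<sigma> i))" if "i \<le> Suc m" for i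
      using vertex_on_std_prod[OF g \<zeta> k' that] vertex_act[OF K \<sigma> k that] by simp
    \<comment> \<open>Both sides are literally equal unless \<open>\<theta> r\<close> lies between \<open>a\<close> and \<open>b\<close>.\<close>
    have "g 0 (point (?c (\<theta> r)), vertex K m k r) = g 0 (point (\<theta> r), vertex K m k r)"
      using vertices_between_agree[OF K T g v _ _ ab(2) eq[OF v], of "\<theta> r"] \<theta>n[OF r]
      by (auto simp: collapse_def)
    then have "vertex T (Suc m) ?z r = vertex T (Suc m) ?z (Suc r)"
      using vz[of r] vz[of "Suc r"] r by (simp add: \<zeta>_def \<sigma>_def)
    note faces = faces_agree[OF T z r this]
    have face: "act T m (Suc m) \<delta> ?z = g m (\<Theta> s, k)"
      if \<delta>: "\<delta> \<in> ord_maps m (Suc m)" and "compose {..m} \<zeta> \<delta> = \<Theta> s"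
        and "compose {..m} \<sigma> \<delta> = (\<lambda>i\<in>{..m}. i)" for \<delta> s
      using simplicial_map_on_std_prod[OF g \<zeta> k' \<delta>] act_compose[OF K \<delta> \<sigma> k] act_id[OF K k] that
      by simp
    let ?\<delta> = "\<lambda>l\<in>{..m}. if l < r then l else Suc l" and ?\<epsilon> = "\<lambda>l\<in>{..m}. if l \<le> r then l else Suc l"
    have "act T m (Suc m) ?\<delta> ?z = g m (\<Theta> r, k)"
      using r by (intro face) (auto intro!: restrict_in_ord_maps simp: compose_def \<zeta>_def \<sigma>_def \<Theta>_def)
    moreover have "act T m (Suc m) ?\<epsilon> ?z = g m (\<Theta> (Suc r), k)"
      using r by (intro face) (auto intro!: restrict_in_ord_maps simp: compose_def \<zeta>_def \<sigma>_def \<Theta>_def)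
    ultimately show ?thesis
      using faces by simp
  qed
  have "g m (\<Theta> r, k) = g m (\<Theta> 0, k)" if "r \<le> Suc m" for r
    using that by (induction r) (auto simp: step)
  then have "g m (\<Theta> (Suc m), k) = g m (\<Theta> 0, k)"
    by blast
  moreover have "\<Theta> (Suc m) = compose {..m} ?c \<theta>"
    by (auto simp: \<Theta>_def compose_def)
  moreover have "\<Theta> 0 = \<theta>"
    using \<theta> by (auto simp: \<Theta>_def ord_maps_iff extensional_restrict)
  ultimately show ?thesis
    by simp
qed

text \<open>The staircase argument compares \<open>g\<close> at \<open>(a, v)\<close> and \<open>(b, v)\<close> for the vertices \<open>v\<close> of \<open>K\<close>. These
  are the values in degree \<open>0\<close> of the vertices \<open>a\<close> and \<open>b\<close> of the simplex \<open>g\<close> of \<open>T\<^sup>K\<close>, which are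
  themselves maps \<open>\<Delta>[0] \<times> K \<rightarrow> T\<close>.\<close>

theorem nonsingular_internal_hom:
  assumes K: "simplicial_set K" and T: "nonsingular T"
  shows "nonsingular (internal_hom K T)"
  unfolding nonsingular_iff_collapse
proof (intro conjI simplicial_set_internal_hom[OF K] allI ballI impI)
  fix n a b and g :: "nat \<Rightarrow> (nat \<Rightarrow> nat) \<times> 'a \<Rightarrow> 'b"
  assume "g \<in> smp (internal_hom K T) n" and ab: "a < b" "b \<le> n"
    and eq: "vertex (internal_hom K T) n g a = vertex (internal_hom K T) n g b"
  then have g: "simplicial_map (std_simplex n \<times>\<^sub>s K) T g"
    by simp
  have "g 0 (point a, v) = g 0 (point b, v)" if v: "v \<in> smp K 0" for v
  proof -
    have "vertex (internal_hom K T) n g i 0 (point 0, v) = g 0 (point i, v)" for i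
      using v point_in_ord_maps[of 0 0]
      by (simp add: vertex_def act_internal_hom compose_point) (simp add: point_def compose_def)
    then show ?thesis
      using eq by metis
  qed
  note collapse = collapse_first_factor[OF K T g ab this]
  have c: "collapse n a b \<in> ord_maps n n"
    using ab by (simp add: collapse_in_ord_maps)
  show "act (internal_hom K T) n n (collapse n a b) g = g"
    by (rule simplicial_map_eqI[OF act_internal_hom_in[OF K c g] g])
       (auto simp: act_internal_hom collapse)
qed

definition transpose ::
  "'a sset \<Rightarrow> 'k sset \<Rightarrow> (nat \<Rightarrow> 'a \<times> 'k \<Rightarrow> 't) \<Rightarrow> nat \<Rightarrow> 'a \<Rightarrow> nat \<Rightarrow> (nat \<Rightarrow> nat) \<times> 'k \<Rightarrow> 't" where
  "transpose X K f = (\<lambda>n. \<lambda>x\<in>smp X n. \<lambda>m. \<lambda>p\<in>smp (std_simplex n \<times>\<^sub>s K) m.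
     f m (act X m n (fst p) x, snd p))"

text \<open>Evaluation at the universal simplex \<open>id \<in> \<Delta>[n]\<^sub>n\<close>, as in the Yoneda lemma.\<close>

definition untranspose ::
  "'a sset \<Rightarrow> 'k sset \<Rightarrow> (nat \<Rightarrow> 'a \<Rightarrow> nat \<Rightarrow> (nat \<Rightarrow> nat) \<times> 'k \<Rightarrow> 't) \<Rightarrow> nat \<Rightarrow> 'a \<times> 'k \<Rightarrow> 't" where
  "untranspose X K u = (\<lambda>n. \<lambda>p\<in>smp (X \<times>\<^sub>s K) n. u n (fst p) n ((\<lambda>i\<in>{..n}. i), snd p))"

lemma transpose_apply:
  "x \<in> smp X n \<Longrightarrow> \<theta> \<in> ord_maps m n \<Longrightarrow> k \<in> smp K m \<Longrightarrow>
    transpose X K f n x m (\<theta>, k) = f m (act X m n \<theta> x, k)"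
  by (simp add: transpose_def)

lemma untranspose_apply:
  "x \<in> smp X n \<Longrightarrow> k \<in> smp K n \<Longrightarrow> untranspose X K u n (x, k) = u n x n ((\<lambda>i\<in>{..n}. i), k)"
  by (simp add: untranspose_def)

lemma simplicial_map_transpose:
  assumes X: "simplicial_set X" and K: "simplicial_set K" and f: "simplicial_map (X \<times>\<^sub>s K) T f"
  shows "simplicial_map X (internal_hom K T) (transpose X K f)"
proof -
  have in_hom: "simplicial_map (std_simplex n \<times>\<^sub>s K) T (transpose X K f n x)"
    if x: "x \<in> smp X n" for n x
  proof (rule simplicial_mapI)
    fix m p
    show "transpose X K f n x m p \<in> smp T m" if "p \<in> smp (std_simplex n \<times>\<^sub>s K) m"
      using that x act_in[OF X _ x] simplicial_map_in[OF f]
      by (auto simp: transpose_apply)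
    show "transpose X K f n x m p = undefined" if "p \<notin> smp (std_simplex n \<times>\<^sub>s K) m"
      using that x by (auto simp: transpose_def)
  next
    fix l m \<phi> p
    assume \<phi>: "\<phi> \<in> ord_maps l m" and "p \<in> smp (std_simplex n \<times>\<^sub>s K) m"
    then obtain \<theta> k where p: "p = (\<theta>, k)" and \<theta>: "\<theta> \<in> ord_maps m n" and k: "k \<in> smp K m"
      by auto
    show "transpose X K f n x l (act (std_simplex n \<times>\<^sub>s K) l m \<phi> p) =
        act T l m \<phi> (transpose X K f n x m p)"
      unfolding p
      using simplicial_map_act[OF f \<phi>, of "(act X m n \<theta> x, k)"] act_in[OF X \<theta> x] k
        compose_in_ord_maps[OF \<theta> \<phi>] act_in[OF K \<phi> k]
      by (simp add: transpose_apply[OF x] \<theta> act_compose[OF X \<phi> \<theta> x])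
  qed
  show ?thesis
  proof (rule simplicial_mapI)
    fix n x
    show "transpose X K f n x \<in> smp (internal_hom K T) n" if "x \<in> smp X n"
      using in_hom[OF that] by simp
    show "transpose X K f n x = undefined" if "x \<notin> smp X n"
      using that by (simp add: transpose_def)
  next
    fix m n \<theta> x
    assume \<theta>: "\<theta> \<in> ord_maps m n" and x: "x \<in> smp X n"
    show "transpose X K f m (act X m n \<theta> x) =
        act (internal_hom K T) m n \<theta> (transpose X K f n x)"
      by (rule simplicial_map_eqI[OF in_hom[OF act_in[OF X \<theta> x]]
            act_internal_hom_in[OF K \<theta> in_hom[OF x]]])
         (auto simp: transpose_apply x act_in[OF X \<theta>] act_internal_hom compose_in_ord_maps[OF \<theta>]
            act_compose[OF X _ \<theta>])
  qed
qed

lemma simplicial_map_untranspose: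
  assumes X: "simplicial_set X" and K: "simplicial_set K"
    and u: "simplicial_map X (internal_hom K T) u"
  shows "simplicial_map (X \<times>\<^sub>s K) T (untranspose X K u)"
proof (rule simplicial_mapI)
  fix n p
  assume "p \<in> smp (X \<times>\<^sub>s K) n"
  then obtain x k where p: "p = (x, k)" and x: "x \<in> smp X n" and k: "k \<in> smp K n"
    by auto
  have ux: "simplicial_map (std_simplex n \<times>\<^sub>s K) T (u n x)"
    using simplicial_map_in[OF u x] by simp
  show "untranspose X K u n p \<in> smp T n"
    unfolding p untranspose_apply[OF x k] using simplicial_map_in[OF ux] id_in_ord_maps k by simp
next
  fix n p
  assume "p \<notin> smp (X \<times>\<^sub>s K) n"
  then show "untranspose X K u n p = undefined"
    by (auto simp: untranspose_def)
next
  fix m n \<theta> p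
  assume \<theta>: "\<theta> \<in> ord_maps m n" and "p \<in> smp (X \<times>\<^sub>s K) n"
  then obtain x k where p: "p = (x, k)" and x: "x \<in> smp X n" and k: "k \<in> smp K n"
    by auto
  have ux: "simplicial_map (std_simplex n \<times>\<^sub>s K) T (u n x)"
    using simplicial_map_in[OF u x] by simp
  show "untranspose X K u m (act (X \<times>\<^sub>s K) m n \<theta> p) = act T m n \<theta> (untranspose X K u n p)"
    unfolding p using act_in[OF X \<theta> x] act_in[OF K \<theta> k] x k
      simplicial_map_on_std_prod[OF ux id_in_ord_maps k \<theta>]
    by (simp add: untranspose_apply simplicial_map_act[OF u \<theta> x] act_internal_hom id_in_ord_maps
        compose_id_left[OF \<theta>] compose_id_right[OF \<theta>])
qed

section \<open>Independence of the universe, and joint surjectivity\<close>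

definition cocone_image :: "'o set \<Rightarrow> ('o \<Rightarrow> 'a sset) \<Rightarrow> 'b sset \<Rightarrow> ('o \<Rightarrow> nat \<Rightarrow> 'a \<Rightarrow> 'b) \<Rightarrow> 'b sset"
  where "cocone_image I F T \<tau> = T\<lparr>smp := (\<lambda>n. \<Union>j\<in>I. \<tau> j n ` smp (F j) n)\<rparr>"

lemma act_cocone_image [simp]: "act (cocone_image I F T \<tau>) = act T"
  by (simp add: cocone_image_def)

lemma smp_cocone_image: "smp (cocone_image I F T \<tau>) n = (\<Union>j\<in>I. \<tau> j n ` smp (F j) n)"
  by (simp add: cocone_image_def)

lemma ns_cocone_simplicial_map:
  "ns_cocone J F Fm T \<tau> \<Longrightarrow> j \<in> Obj J \<Longrightarrow> simplicial_map (F j) T (\<tau> j)"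
  by (simp add: ns_cocone_def)

lemma ns_cocone_apply:
  assumes "ns_cocone J F Fm T \<tau>" and "\<alpha> \<in> Arr J" and "x \<in> smp (F (Dom J \<alpha>)) n"
  shows "\<tau> (Cod J \<alpha>) n (Fm \<alpha> n x) = \<tau> (Dom J \<alpha>) n x"
  using assms smap_comp_apply[OF assms(3)] by (metis ns_cocone_def)

lemma ns_diagram_simplicial_set: "ns_diagram J F Fm \<Longrightarrow> j \<in> Obj J \<Longrightarrow> simplicial_set (F j)"
  by (simp add: ns_diagram_def nonsingular_def)

text \<open>The images of the components of a cocone form a simplicial subset of \<open>T\<close>, and simplicial subsets
  of \<open>T\<close> are non-singular.\<close>

lemma ns_cocone_cocone_image:
  assumes D: "ns_diagram J F Fm" and T: "ns_cocone J F Fm T \<tau>"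
  shows "ns_cocone J F Fm (cocone_image (Obj J) F T \<tau>) \<tau>"
    and "simplicial_map (cocone_image (Obj J) F T \<tau>) T (smap_id (cocone_image (Obj J) F T \<tau>))"
proof -
  let ?I = "cocone_image (Obj J) F T \<tau>"
  note map = ns_cocone_simplicial_map[OF T]
  have nsT: "nonsingular T"
    using T by (simp add: ns_cocone_def)
  note ssT = nonsingular_simplicial_set[OF nsT]
  have sub: "x \<in> smp T n" if "x \<in> smp ?I n" for x n
    using that simplicial_map_in[OF map] by (auto simp: smp_cocone_image)
  have closed: "act T m n \<theta> x \<in> smp ?I m" if \<theta>: "\<theta> \<in> ord_maps m n" and x: "x \<in> smp ?I n" for m n \<theta> x
  proof -
    obtain j y where j: "j \<in> Obj J" and y: "y \<in> smp (F j) n" and "x = \<tau> j n y"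
      using x by (auto simp: smp_cocone_image)
    then have "act T m n \<theta> x = \<tau> j m (act (F j) m n \<theta> y)"
      using simplicial_map_act[OF map[OF j] \<theta> y] by simp
    then show ?thesis
      using j act_in[OF ns_diagram_simplicial_set[OF D j] \<theta> y] by (auto simp: smp_cocone_image)
  qed
  have ss: "simplicial_set ?I"
    by (rule simplicial_setI) (use closed sub in \<open>auto simp: act_id[OF ssT] act_compose[OF ssT]\<close>)
  show incl: "simplicial_map ?I T (smap_id ?I)"
    by (rule simplicial_mapI) (use closed sub in \<open>auto simp: smap_id_def\<close>)
  have "nonsingular ?I"
    by (rule nonsingular_embedding[OF ss nsT incl]) (auto simp: smap_id_def inj_on_def)
  moreover have "simplicial_map (F j) ?I (\<tau> j)" if j: "j \<in> Obj J" for j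
    by (rule simplicial_mapI)
       (use j map[OF j] in \<open>auto simp: smp_cocone_image simplicial_map_act simplicial_map_undefined\<close>)
  ultimately show "ns_cocone J F Fm ?I \<tau>"
    using T by (simp add: ns_cocone_def)
qed

lemma ns_cocone_postcomp:
  assumes D: "ns_diagram J F Fm" and J: "category J" and T: "ns_cocone J F Fm T \<tau>"
    and f: "simplicial_map T S f" and S: "nonsingular S"
  shows "ns_cocone J F Fm S (\<lambda>j. smap_comp (F j) f (\<tau> j))"
  unfolding ns_cocone_def
proof (intro conjI S ballI)
  show map: "simplicial_map (F j) S (smap_comp (F j) f (\<tau> j))" if "j \<in> Obj J" for j
    by (rule simplicial_map_smap_comp[OF ns_diagram_simplicial_set[OF D that]
          ns_cocone_simplicial_map[OF T that] f])
  fix \<alpha> assume \<alpha>: "\<alpha> \<in> Arr J"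
  then have o: "Dom J \<alpha> \<in> Obj J" "Cod J \<alpha> \<in> Obj J"
    using J by (simp_all add: category.Dom_in category.Cod_in)
  have F\<alpha>: "simplicial_map (F (Dom J \<alpha>)) (F (Cod J \<alpha>)) (Fm \<alpha>)"
    using D \<alpha> by (simp add: ns_diagram_def)
  show "smap_comp (F (Dom J \<alpha>)) (smap_comp (F (Cod J \<alpha>)) f (\<tau> (Cod J \<alpha>))) (Fm \<alpha>) =
      smap_comp (F (Dom J \<alpha>)) f (\<tau> (Dom J \<alpha>))"
    by (rule simplicial_map_eqI[OF simplicial_map_smap_comp[OF ns_diagram_simplicial_set[OF D o(1)] F\<alpha>
            map[OF o(2)]] map[OF o(1)]])
       (simp add: smap_comp_apply simplicial_map_in[OF F\<alpha>] ns_cocone_apply[OF T \<alpha>])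
qed

text \<open>The colimit cocone is also a cocone to its own image in \<open>L\<close>. The map \<open>r\<close> that it induces from
  \<open>L\<close> to the image becomes an endomorphism of \<open>L\<close> compatible with the cocone when followed by the
  inclusion. This endomorphism must be the identity, so the image is all of \<open>L\<close>.\<close>

lemma ns_colimit_jointly_surjective:
  fixes L :: "'u sset" and F :: "'o \<Rightarrow> 'a sset"
  assumes colim: "ns_colimit TYPE('u) J F Fm L \<iota>" and x: "x \<in> smp L n"
  shows "\<exists>j\<in>Obj J. \<exists>y\<in>smp (F j) n. x = \<iota> j n y"
proof -
  let ?I = "cocone_image (Obj J) F L \<iota>"
  have D: "ns_diagram J F Fm" and C: "ns_cocone J F Fm L \<iota>"
    and univ: "\<And>(T :: 'u sset) \<tau>. ns_cocone J F Fm T \<tau> \<Longrightarrow>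
      \<exists>!u. simplicial_map L T u \<and> (\<forall>j\<in>Obj J. smap_comp (F j) u (\<iota> j) = \<tau> j)"
    using colim unfolding ns_colimit_def by blast+
  note image = ns_cocone_cocone_image[OF D C]
  have L: "simplicial_set L"
    using C by (simp add: ns_cocone_def nonsingular_def)
  obtain r where r: "simplicial_map L ?I r" and r\<iota>: "\<forall>j\<in>Obj J. smap_comp (F j) r (\<iota> j) = \<iota> j"
    using univ[OF image(1)] by blast
  let ?r = "smap_comp L (smap_id ?I) r"
  have r': "simplicial_map L L ?r"
    by (rule simplicial_map_smap_comp[OF L r image(2)])
  have id': "simplicial_map L L (smap_id L)"
    by (rule simplicial_map_smap_id[OF L])
  have "smap_comp (F j) ?r (\<iota> j) = \<iota> j \<and> smap_comp (F j) (smap_id L) (\<iota> j) = \<iota> j"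
    if j: "j \<in> Obj J" for j
  proof (intro conjI)
    note \<iota> = ns_cocone_simplicial_map[OF C j]
    note Fj = ns_diagram_simplicial_set[OF D j]
    have "r n (\<iota> j n y) = \<iota> j n y" if "y \<in> smp (F j) n" for n y
      using r\<iota> j smap_comp_apply[OF that] by metis
    then show "smap_comp (F j) ?r (\<iota> j) = \<iota> j"
      using j by (intro simplicial_map_eqI[OF simplicial_map_smap_comp[OF Fj \<iota> r'] \<iota>])
         (auto simp: smap_comp_apply simplicial_map_in[OF \<iota>] smap_id_def smp_cocone_image)
    show "smap_comp (F j) (smap_id L) (\<iota> j) = \<iota> j"
      by (rule simplicial_map_eqI[OF simplicial_map_smap_comp[OF Fj \<iota> id'] \<iota>])
         (auto simp: smap_comp_apply simplicial_map_in[OF \<iota>] smap_id_def)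
  qed
  with univ[OF C] r' id' have "?r = smap_id L"
    by blast
  then have "?r n x = x"
    using x by (simp add: smap_id_def)
  moreover have "r n x \<in> smp ?I n"
    by (rule simplicial_map_in[OF r x])
  ultimately have "x \<in> smp ?I n"
    using x by (simp add: smap_comp_apply smap_id_def)
  then show ?thesis
    by (auto simp: smp_cocone_image)
qed

lemma nonsingular_transport:
  fixes X :: "'a sset"
  assumes X: "nonsingular X" and small: "(\<Union>n. smp X n) \<lesssim> (UNIV :: 'u set)"
  obtains Y :: "'u sset" and f g where "nonsingular Y"
    and "simplicial_map X Y f" and "simplicial_map Y X g"
    and "\<And>n x. x \<in> smp X n \<Longrightarrow> g n (f n x) = x"
proof -
  obtain h :: "'a \<Rightarrow> 'u" where h: "inj_on h (\<Union>n. smp X n)"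
    using small by (auto simp: lepoll_def)
  define h' where "h' = inv_into (\<Union>n. smp X n) h"
  have h'h: "h' (h x) = x" if "x \<in> smp X n" for x n
    unfolding h'_def using that by (intro inv_into_f_f[OF h]) auto
  define Y where "Y = \<lparr>smp = (\<lambda>n. h ` smp X n), act = (\<lambda>m n \<theta> y. h (act X m n \<theta> (h' y)))\<rparr>"
  define f where "f n = restrict h (smp X n)" for n
  define g where "g n = restrict h' (smp Y n)" for n
  note ss = nonsingular_simplicial_set[OF X]
  have Y: "simplicial_set Y"
    by (rule simplicial_setI)
       (auto simp: Y_def h'h act_in[OF ss] act_id[OF ss] act_compose[OF ss] intro!: imageI,
        metis act_in[OF ss] h'h)
  have f: "simplicial_map X Y f"
    by (rule simplicial_mapI) (auto simp: f_def Y_def h'h act_in[OF ss])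
  have g: "simplicial_map Y X g"
  proof (rule simplicial_mapI)
    fix m n \<theta> y
    assume \<theta>: "\<theta> \<in> ord_maps m n" and y: "y \<in> smp Y n"
    then obtain x where x: "x \<in> smp X n" and yx: "y = h x"
      by (auto simp: Y_def)
    show "g m (act Y m n \<theta> y) = act X m n \<theta> (g n y)"
      using act_in[OF Y \<theta> y] y act_in[OF ss \<theta> x] x unfolding g_def
      by (simp add: yx h'h[OF x]) (simp add: Y_def h'h[OF x] h'h[OF act_in[OF ss \<theta> x]])
  qed (auto simp: g_def Y_def h'h)
  have "inj_on (g n) (smp Y n)" for n
    unfolding inj_on_def g_def by (auto simp: Y_def h'h)
  then have "nonsingular Y"
    by (rule nonsingular_embedding[OF Y X g])
  moreover have "g n (f n x) = x" if "x \<in> smp X n" for n x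
    using that by (simp add: g_def f_def Y_def h'h)
  ultimately show thesis
    using f g by (intro that)
qed

text \<open>A simplex in the image is named by an object, a dimension and an element of \<open>'u\<close>, and a product
  of three sets of size at most that of the infinite \<open>'u\<close> is again of at most this size.\<close>

lemma cocone_image_lepoll:
  fixes F :: "'o \<Rightarrow> 'u sset"
  assumes inf: "infinite (UNIV :: 'u set)" and I: "I \<lesssim> (UNIV :: 'u set)"
  shows "(\<Union>n. smp (cocone_image I F T \<tau>) n) \<lesssim> (UNIV :: 'u set)"
proof -
  have sq: "(UNIV :: 'u set) \<times> (UNIV :: 'u set) \<lesssim> (UNIV :: 'u set)"
    using card_of_Times_same_infinite[OF inf]
    by (intro eqpoll_imp_lepoll) (simp add: eqpoll_iff_card_of_ordIso)
  have nat: "(UNIV :: nat set) \<lesssim> (UNIV :: 'u set)"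
    using inf by (simp add: infinite_le_lepoll)
  have "(\<Union>n. smp (cocone_image I F T \<tau>) n) \<subseteq> (\<lambda>(j, n, x). \<tau> j n x) ` (I \<times> UNIV \<times> UNIV)"
    by (auto simp: smp_cocone_image image_iff) blast
  then have "(\<Union>n. smp (cocone_image I F T \<tau>) n) \<lesssim> I \<times> (UNIV :: nat set) \<times> (UNIV :: 'u set)"
    by (rule lepoll_trans[OF subset_imp_lepoll image_lepoll])
  also have "\<dots> \<lesssim> (UNIV :: 'u set) \<times> (UNIV :: 'u set) \<times> (UNIV :: 'u set)"
    by (intro times_lepoll_mono I nat lepoll_refl)
  also have "\<dots> \<lesssim> (UNIV :: 'u set) \<times> (UNIV :: 'u set)"
    by (intro times_lepoll_mono lepoll_refl sq)
  also note sq
  finally show ?thesis .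
qed

text \<open>Universality for targets with simplices in \<open>'u\<close> gives factorizations for targets of any type,
  because the image of a cocone has an isomorphic copy with simplices in \<open>'u\<close>.\<close>

lemma ns_colimit_factorization:
  fixes F :: "'o \<Rightarrow> 'u sset" and L :: "'u sset" and T :: "'t sset"
  assumes J: "category J" and inf: "infinite (UNIV :: 'u set)" and small: "Obj J \<lesssim> (UNIV :: 'u set)"
    and colim: "ns_colimit TYPE('u) J F Fm L \<iota>" and T: "ns_cocone J F Fm T \<tau>"
  obtains u where "simplicial_map L T u"
    and "\<And>j n x. j \<in> Obj J \<Longrightarrow> x \<in> smp (F j) n \<Longrightarrow> u n (\<iota> j n x) = \<tau> j n x"
proof -
  let ?I = "cocone_image (Obj J) F T \<tau>"
  have D: "ns_diagram J F Fm" and C: "ns_cocone J F Fm L \<iota>"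
    and univ: "\<And>(S :: 'u sset) \<sigma>. ns_cocone J F Fm S \<sigma> \<Longrightarrow>
      \<exists>!u. simplicial_map L S u \<and> (\<forall>j\<in>Obj J. smap_comp (F j) u (\<iota> j) = \<sigma> j)"
    using colim unfolding ns_colimit_def by blast+
  have L: "simplicial_set L"
    using C by (simp add: ns_cocone_def nonsingular_def)
  note image = ns_cocone_cocone_image[OF D T]
  have nsI: "nonsingular ?I"
    using image(1) by (simp add: ns_cocone_def)
  obtain Y :: "'u sset" and f g where Y: "nonsingular Y" and f: "simplicial_map ?I Y f"
    and g: "simplicial_map Y ?I g" and gf: "\<And>n x. x \<in> smp ?I n \<Longrightarrow> g n (f n x) = x"
    using nonsingular_transport[OF nsI cocone_image_lepoll[OF inf small]] by blast
  obtain v where v: "simplicial_map L Y v"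
    and v\<iota>: "\<forall>j\<in>Obj J. smap_comp (F j) v (\<iota> j) = smap_comp (F j) f (\<tau> j)"
    using univ[OF ns_cocone_postcomp[OF D J image(1) f Y]] by blast
  let ?u = "smap_comp L (smap_comp Y (smap_id ?I) g) v"
  have u: "simplicial_map L T ?u"
    by (intro simplicial_map_smap_comp[OF L v]
        simplicial_map_smap_comp[OF nonsingular_simplicial_set[OF Y] g image(2)])
  have "?u n (\<iota> j n x) = \<tau> j n x" if j: "j \<in> Obj J" and x: "x \<in> smp (F j) n" for j n x
  proof -
    have l: "\<iota> j n x \<in> smp L n"
      by (rule simplicial_map_in[OF ns_cocone_simplicial_map[OF C j] x])
    have t: "\<tau> j n x \<in> smp ?I n"
      using j x by (auto simp: smp_cocone_image)
    have "v n (\<iota> j n x) = f n (\<tau> j n x)"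
      using v\<iota> j smap_comp_apply[OF x] by metis
    then show ?thesis
      using l t simplicial_map_in[OF f t] by (simp add: smap_comp_apply gf smap_id_def)
  qed
  with u show thesis
    by (rule that)
qed

section \<open>Products preserve colimits\<close>

lemma smap_times_apply:
  "x \<in> smp X n \<Longrightarrow> k \<in> smp K n \<Longrightarrow> smap_times X K f n (x, k) = (f n x, k)"
  by (simp add: smap_times_def)

lemma simplicial_map_smap_times:
  assumes "simplicial_set X" and "simplicial_set K" and f: "simplicial_map X Y f"
  shows "simplicial_map (X \<times>\<^sub>s K) (Y \<times>\<^sub>s K) (smap_times X K f)"
  using assms by (intro simplicial_mapI)
    (auto simp: smap_times_apply simplicial_map_in simplicial_map_act act_in,
     auto simp: smap_times_def split: if_splits)

lemma smap_comp_smap_times: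
  assumes f: "simplicial_map X Y f"
  shows "smap_comp (X \<times>\<^sub>s K) (smap_times Y K g) (smap_times X K f) = smap_times X K (smap_comp X g f)"
  by (intro ext)
     (auto simp: smap_comp_def compose_def smap_times_def simplicial_map_in[OF f])

lemma ns_diagram_times:
  assumes K: "nonsingular K" and J: "category J" and D: "ns_diagram J F Fm"
  shows "ns_diagram J (\<lambda>j. F j \<times>\<^sub>s K) (\<lambda>\<alpha>. smap_times (F (Dom J \<alpha>)) K (Fm \<alpha>))"
proof -
  interpret category J by fact
  have map: "simplicial_map (F (Dom J \<alpha>)) (F (Cod J \<alpha>)) (Fm \<alpha>)" if "\<alpha> \<in> Arr J" for \<alpha>
    using that D by (simp add: ns_diagram_def)
  have "smap_times (F j) K (smap_id (F j)) = smap_id (F j \<times>\<^sub>s K)" for j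
    by (intro ext) (auto simp: smap_times_def smap_id_def)
  moreover have "smap_comp (F (Dom J \<alpha>) \<times>\<^sub>s K) (smap_times (F (Dom J \<beta>)) K (Fm \<beta>))
        (smap_times (F (Dom J \<alpha>)) K (Fm \<alpha>)) =
      smap_times (F (Dom J \<alpha>)) K (smap_comp (F (Dom J \<alpha>)) (Fm \<beta>) (Fm \<alpha>))"
    if "\<alpha> \<in> Arr J" "Dom J \<beta> = Cod J \<alpha>" for \<alpha> \<beta>
    using smap_comp_smap_times[OF map[OF that(1)]] that(2) by simp
  ultimately show ?thesis
    using D unfolding ns_diagram_def
    by (auto simp: nonsingular_prod K simplicial_map_smap_times nonsingular_simplicial_set
        Dom_in Dom_Ident Dom_Comp)
qed

lemma ns_cocone_times:
  assumes K: "nonsingular K" and J: "category J" and D: "ns_diagram J F Fm"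
    and C: "ns_cocone J F Fm L \<iota>"
  shows "ns_cocone J (\<lambda>j. F j \<times>\<^sub>s K) (\<lambda>\<alpha>. smap_times (F (Dom J \<alpha>)) K (Fm \<alpha>))
    (L \<times>\<^sub>s K) (\<lambda>j. smap_times (F j) K (\<iota> j))"
proof -
  have "smap_comp (F (Dom J \<alpha>) \<times>\<^sub>s K) (smap_times (F (Cod J \<alpha>)) K (\<iota> (Cod J \<alpha>)))
        (smap_times (F (Dom J \<alpha>)) K (Fm \<alpha>)) = smap_times (F (Dom J \<alpha>)) K (\<iota> (Dom J \<alpha>))"
    if "\<alpha> \<in> Arr J" for \<alpha>
  proof -
    have "simplicial_map (F (Dom J \<alpha>)) (F (Cod J \<alpha>)) (Fm \<alpha>)"
      using D that by (simp add: ns_diagram_def)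
    moreover have "smap_comp (F (Dom J \<alpha>)) (\<iota> (Cod J \<alpha>)) (Fm \<alpha>) = \<iota> (Dom J \<alpha>)"
      using C that by (simp add: ns_cocone_def)
    ultimately show ?thesis
      by (simp add: smap_comp_smap_times)
  qed
  then show ?thesis
    using C nonsingular_simplicial_set[OF K] ns_diagram_simplicial_set[OF D]
    by (simp add: ns_cocone_def nonsingular_prod K simplicial_map_smap_times)
qed

text \<open>Compatibility with the arrows of the diagram is preserved because transposition is natural in
  its source.\<close>

lemma ns_cocone_transpose:
  assumes K: "simplicial_set K" and J: "category J" and D: "ns_diagram J F Fm"
    and C: "ns_cocone J (\<lambda>j. F j \<times>\<^sub>s K) (\<lambda>\<alpha>. smap_times (F (Dom J \<alpha>)) K (Fm \<alpha>)) T \<tau>"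
  shows "ns_cocone J F Fm (internal_hom K T) (\<lambda>j. transpose (F j) K (\<tau> j))"
  unfolding ns_cocone_def
proof (intro conjI ballI)
  have T: "nonsingular T"
    using C by (simp add: ns_cocone_def)
  show "nonsingular (internal_hom K T)"
    by (rule nonsingular_internal_hom[OF K T])
  show map: "simplicial_map (F j) (internal_hom K T) (transpose (F j) K (\<tau> j))"
    if j: "j \<in> Obj J" for j
    by (rule simplicial_map_transpose[OF ns_diagram_simplicial_set[OF D j] K
          ns_cocone_simplicial_map[OF C j]])
  fix \<alpha> assume \<alpha>: "\<alpha> \<in> Arr J"
  let ?i = "Dom J \<alpha>" and ?j = "Cod J \<alpha>"
  have o: "?i \<in> Obj J" "?j \<in> Obj J"
    using J \<alpha> by (simp_all add: category.Dom_in category.Cod_in)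
  note Fi = ns_diagram_simplicial_set[OF D o(1)]
  have F\<alpha>: "simplicial_map (F ?i) (F ?j) (Fm \<alpha>)"
    using D \<alpha> by (simp add: ns_diagram_def)
  have \<tau>: "\<tau> ?j m (Fm \<alpha> m y, k) = \<tau> ?i m (y, k)" if "y \<in> smp (F ?i) m" "k \<in> smp K m" for m y k
    using ns_cocone_apply[OF C \<alpha>, of "(y, k)" m] that by (simp add: smap_times_apply)
  show "smap_comp (F ?i) (transpose (F ?j) K (\<tau> ?j)) (Fm \<alpha>) = transpose (F ?i) K (\<tau> ?i)"
  proof (rule simplicial_map_eqI[OF simplicial_map_smap_comp[OF Fi F\<alpha> map[OF o(2)]] map[OF o(1)]])
    fix n x
    assume x: "x \<in> smp (F ?i) n"
    have "transpose (F ?j) K (\<tau> ?j) n (Fm \<alpha> n x) = transpose (F ?i) K (\<tau> ?i) n x"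
    proof (rule simplicial_map_eqI[where X = "std_simplex n \<times>\<^sub>s K"])
      show "simplicial_map (std_simplex n \<times>\<^sub>s K) T (transpose (F ?j) K (\<tau> ?j) n (Fm \<alpha> n x))"
        using simplicial_map_in[OF map[OF o(2)] simplicial_map_in[OF F\<alpha> x]] by simp
      show "simplicial_map (std_simplex n \<times>\<^sub>s K) T (transpose (F ?i) K (\<tau> ?i) n x)"
        using simplicial_map_in[OF map[OF o(1)] x] by simp
    qed (auto simp: transpose_apply x simplicial_map_in[OF F\<alpha> x] simplicial_map_act[OF F\<alpha> _ x, symmetric]
          \<tau> act_in[OF Fi _ x])
    then show "smap_comp (F ?i) (transpose (F ?j) K (\<tau> ?j)) (Fm \<alpha>) n x = transpose (F ?i) K (\<tau> ?i) n x"
      by (simp add: smap_comp_apply[OF x])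
  qed
qed

theorem proposition1p2:
  fixes K :: "'k sset"
    and J :: "('o, 'm) cat"
    and F :: "'o \<Rightarrow> 'u sset"
    and Fm :: "'m \<Rightarrow> nat \<Rightarrow> 'u \<Rightarrow> 'u"
    and L :: "'u sset"
    and \<iota> :: "'o \<Rightarrow> nat \<Rightarrow> 'u \<Rightarrow> 'u"
  assumes "nonsingular K"
    and "category J"
    and "infinite (UNIV :: 'u set)"
    and "Obj J \<lesssim> (UNIV :: 'u set)"
    and "ns_colimit TYPE('u) J F Fm L \<iota>"
  shows "ns_colimit TYPE('t) J
           (\<lambda>j. F j \<times>\<^sub>s K) (\<lambda>\<alpha>. smap_times (F (Dom J \<alpha>)) K (Fm \<alpha>))
           (L \<times>\<^sub>s K) (\<lambda>j. smap_times (F j) K (\<iota> j))"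
proof -
  note K = nonsingular_simplicial_set[OF assms(1)]
  have D: "ns_diagram J F Fm" and C: "ns_cocone J F Fm L \<iota>"
    using assms(5) by (simp_all add: ns_colimit_def)
  have L: "simplicial_set L"
    using C by (simp add: ns_cocone_def nonsingular_def)
  note DK = ns_diagram_times[OF assms(1,2) D]
  note CK = ns_cocone_times[OF assms(1,2) D C]
  show ?thesis
    unfolding ns_colimit_def
  proof (intro conjI DK CK allI impI)
    fix T :: "'t sset" and \<tau>
    assume T: "ns_cocone J (\<lambda>j. F j \<times>\<^sub>s K) (\<lambda>\<alpha>. smap_times (F (Dom J \<alpha>)) K (Fm \<alpha>)) T \<tau>"
    let ?mediates = "\<lambda>w. simplicial_map (L \<times>\<^sub>s K) T w \<and>
      (\<forall>j\<in>Obj J. smap_comp (F j \<times>\<^sub>s K) w (smap_times (F j) K (\<iota> j)) = \<tau> j)"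
    obtain u where u: "simplicial_map L (internal_hom K T) u"
      and u\<iota>: "\<And>j n x. j \<in> Obj J \<Longrightarrow> x \<in> smp (F j) n \<Longrightarrow> u n (\<iota> j n x) = transpose (F j) K (\<tau> j) n x"
      using ns_colimit_factorization[OF assms(2-5) ns_cocone_transpose[OF K assms(2) D T]] by blast
    show "\<exists>!w. ?mediates w"
    proof (rule ex1I)
      let ?w = "untranspose L K u"
      have w: "simplicial_map (L \<times>\<^sub>s K) T ?w"
        by (rule simplicial_map_untranspose[OF L K u])
      moreover have "smap_comp (F j \<times>\<^sub>s K) ?w (smap_times (F j) K (\<iota> j)) = \<tau> j" if j: "j \<in> Obj J" for j
      proof (rule simplicial_map_eqI)
        note Fj = ns_diagram_simplicial_set[OF D j]
        note \<iota> = ns_cocone_simplicial_map[OF C j]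
        show "simplicial_map (F j \<times>\<^sub>s K) T (smap_comp (F j \<times>\<^sub>s K) ?w (smap_times (F j) K (\<iota> j)))"
          by (rule simplicial_map_smap_comp[OF simplicial_set_prod[OF Fj K]
                simplicial_map_smap_times[OF Fj K \<iota>] w])
        show "simplicial_map (F j \<times>\<^sub>s K) T (\<tau> j)"
          by (rule ns_cocone_simplicial_map[OF T j])
        fix n p
        assume "p \<in> smp (F j \<times>\<^sub>s K) n"
        then obtain x k where p: "p = (x, k)" and x: "x \<in> smp (F j) n" and k: "k \<in> smp K n"
          by auto
        show "smap_comp (F j \<times>\<^sub>s K) ?w (smap_times (F j) K (\<iota> j)) n p = \<tau> j n p"
          unfolding p using x k
          by (simp add: smap_comp_apply smap_times_apply untranspose_apply simplicial_map_in[OF \<iota>]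
              u\<iota>[OF j] transpose_apply id_in_ord_maps act_id[OF Fj])
      qed
      ultimately show "?mediates ?w"
        by blast
      fix w'
      assume w': "?mediates w'"
      show "w' = ?w"
      proof (rule simplicial_map_eqI[OF conjunct1[OF w'] w])
        fix n p
        assume "p \<in> smp (L \<times>\<^sub>s K) n"
        then obtain j x k where j: "j \<in> Obj J" and x: "x \<in> smp (F j) n" and k: "k \<in> smp K n"
          and p: "p = smap_times (F j) K (\<iota> j) n (x, k)"
          using ns_colimit_jointly_surjective[OF assms(5)] by (force simp: smap_times_apply)
        have determined: "v n p = \<tau> j n (x, k)" if "?mediates v" for v
        proof -
          have "smap_comp (F j \<times>\<^sub>s K) v (smap_times (F j) K (\<iota> j)) = \<tau> j"
            using that j by blast
          then show ?thesis
            using smap_comp_apply[of "(x, k)" "F j \<times>\<^sub>s K" n v] x k p by (metis SigmaI smp_prod)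
        qed
        show "w' n p = ?w n p"
          unfolding determined[OF w'] determined[OF \<open>?mediates ?w\<close>] ..
      qed
    qed
  qed
qed

end
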